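(* For every integer $m\ge 2$, $\pi_f(K_{m,m})=\frac{3m}{m+1}$.
   Context: Two edges are nonincident if they share no endpoint. A linear ordering of $V(G)$ separates a pair of nonincident edges if both endpoints of one edge precede both endpoints of the other. $\pi_t(G)$ is the minimum length of a list of linear orderings of $V(G)$ (repetitions allowed) separating every pair of nonincident edges at least $t$ times, and the fractional separation dimension is $\pi_f(G)=\liminf_{t\to\infty}\pi_t(G)/t$ (equivalently the minimum of $a/b$ over lists of $a$ orderings separating every nonincident pair at least $b$ times). $K_{m,m}$ is the complete bipartite graph with parts of size $m$. *)

theory Defs
  imports "HOL-Analysis.Analysis"
begin

text \<open>
  Graphs are finite, simple and undirected, given by a vertex set and a set of edges,
  each edge being the two-element set of its endpoints.
\<close>

definition simple_graph :: "'a set \<Rightarrow> 'a set set \<Rightarrow> bool" where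
  "simple_graph V E \<longleftrightarrow> finite V \<and> (\<forall>e\<in>E. e \<subseteq> V \<and> card e = 2)"

definition is_complete_bipartite :: "nat \<Rightarrow> nat \<Rightarrow> 'a set \<Rightarrow> 'a set set \<Rightarrow> bool" where
  "is_complete_bipartite m n V E \<longleftrightarrow>
     (\<exists>A B. finite A \<and> finite B \<and> card A = m \<and> card B = n \<and> A \<inter> B = {} \<and>
            V = A \<union> B \<and> E = {{a, b} | a b. a \<in> A \<and> b \<in> B})"

definition nonincident :: "'a set \<Rightarrow> 'a set \<Rightarrow> bool" where
  "nonincident e f \<longleftrightarrow> e \<inter> f = {}"

text \<open>
  Linear orderings are reflexive relations, as in \<^const>\<open>linear_order_on\<close>. This is harmless
  in the next definition, which is only applied to disjoint edges.
\<close>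

definition separates :: "'a rel \<Rightarrow> 'a set \<Rightarrow> 'a set \<Rightarrow> bool" where
  "separates r e f \<longleftrightarrow>
     (\<forall>x\<in>e. \<forall>y\<in>f. (x, y) \<in> r) \<or> (\<forall>x\<in>e. \<forall>y\<in>f. (y, x) \<in> r)"

definition separating_list :: "'a set \<Rightarrow> 'a set set \<Rightarrow> nat \<Rightarrow> 'a rel list \<Rightarrow> bool" where
  "separating_list V E t rs \<longleftrightarrow>
     (\<forall>r\<in>set rs. linear_order_on V r) \<and>
     (\<forall>e\<in>E. \<forall>f\<in>E. nonincident e f \<longrightarrow>
        t \<le> card {i. i < length rs \<and> separates (rs ! i) e f})"

definition sep_dim :: "nat \<Rightarrow> 'a set \<Rightarrow> 'a set set \<Rightarrow> nat" where
  "sep_dim t V E = (LEAST a. \<exists>rs. separating_list V E t rs \<and> length rs = a)"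

definition frac_sep_dim :: "'a set \<Rightarrow> 'a set set \<Rightarrow> ereal" where
  "frac_sep_dim V E = liminf (\<lambda>t. ereal (real (sep_dim t V E) / real t))"

lemma complete_bipartite_simple_graph:
  assumes "is_complete_bipartite m n V E"
  shows "simple_graph V E"
proof -
  obtain A B where AB: "finite A" "finite B" "A \<inter> B = {}" "V = A \<union> B"
    "E = {{a, b} | a b. a \<in> A \<and> b \<in> B}"
    using assms unfolding is_complete_bipartite_def by blast
  have "card {a, b} = 2" if "a \<in> A" "b \<in> B" for a b
    using that AB(3) by (metis card_2_iff disjoint_iff)
  then show ?thesis
    using AB unfolding simple_graph_def by auto
qed

lemma exists_separating_order:
  assumes "finite V" "e \<subseteq> V" "f \<subseteq> V" "nonincident e f"
  shows "\<exists>r. linear_order_on V r \<and> separates r e f"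
proof -
  obtain g :: "'a \<Rightarrow> nat" where g: "inj_on g V"
    using finite_imp_inj_to_nat_seg[OF assms(1)] by blast
  define w where "w x = (if x \<in> e then 0 else 1 :: nat)" for x
  define r where
    "r = {(x, y). x \<in> V \<and> y \<in> V \<and> (w x < w y \<or> w x = w y \<and> g x \<le> g y)}"
  have "antisym r"
    using g by (auto simp: antisym_def r_def inj_on_def)
  moreover have "trans r"
    by (rule transI) (auto simp: r_def)
  moreover have "refl_on V r" "total_on V r" "r \<subseteq> V \<times> V"
    by (auto simp: refl_on_def total_on_def r_def)
  ultimately have "linear_order_on V r"
    by (auto simp: order_on_defs)
  moreover have "separates r e f"
    using assms(2-4) unfolding separates_def nonincident_def r_def w_def by auto
  ultimately show ?thesis by blast
qed

text \<open>The minimum in \<^const>\<open>sep_dim\<close> is always taken over a nonempty set.\<close>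

lemma exists_separating_list:
  assumes "simple_graph V E"
  shows "\<exists>rs. separating_list V E t rs"
proof -
  have fin: "finite V" and sub: "\<And>e. e \<in> E \<Longrightarrow> e \<subseteq> V"
    using assms by (auto simp: simple_graph_def)
  define P where "P = {p \<in> E \<times> E. nonincident (fst p) (snd p)}"
  have "finite E"
    using fin sub by (meson Pow_iff finite_Pow_iff finite_subset subsetI)
  then have "finite P" by (simp add: P_def)
  then obtain ps where ps: "set ps = P" using finite_list by blast
  have "\<forall>p\<in>P. \<exists>r. linear_order_on V r \<and> separates r (fst p) (snd p)"
    using exists_separating_order[OF fin] sub by (auto simp: P_def)
  then obtain h where h: "\<And>p. p \<in> P \<Longrightarrow> linear_order_on V (h p)"
    "\<And>p. p \<in> P \<Longrightarrow> separates (h p) (fst p) (snd p)"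
    by metis
  define rs where "rs = concat (map (\<lambda>p. replicate t (h p)) ps)"
  have "t \<le> card {i. i < length rs \<and> separates (rs ! i) e f}"
    if "e \<in> E" "f \<in> E" "nonincident e f" for e f
  proof -
    have "(e, f) \<in> set ps" using that ps by (simp add: P_def)
    then obtain us vs where "ps = us @ (e, f) # vs" by (meson split_list)
    moreover have "separates (h (e, f)) e f"
      using h(2)[of "(e, f)"] that by (simp add: P_def)
    ultimately have "t \<le> length (filter (\<lambda>r. separates r e f) rs)"
      by (simp add: rs_def)
    then show ?thesis by (simp add: length_filter_conv_card)
  qed
  moreover have "\<forall>r\<in>set rs. linear_order_on V r"
    using h(1) ps by (auto simp: rs_def)
  ultimately show ?thesis unfolding separating_list_def by blast
qed

end

theory Submission
  imports Defs
begin

text \<open>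
  Choose two vertices \<open>a, a'\<close> of \<open>A\<close> and two vertices \<open>b, b'\<close> of \<open>B\<close>. A linear order separates exactly
  one of the two perfect matchings between them, unless both vertices of one part precede both
  vertices of the other. If \<open>p\<close> vertices of \<open>A\<close> and \<open>x\<close> vertices of \<open>B\<close> precede \<open>a\<close>, the number
  of bad choices in which \<open>a\<close> is the vertex of \<open>A\<close> nearer to \<open>B\<close> is, up to a constant factor,
  \<open>p (m - x) (m - x - 1) + (m - 1 - p) x (x - 1) = (m - 1) (p (m - 1 - p) + (x - p) (x - p - 1))\<close>.
  As \<open>p\<close> runs through \<open>0, \<dots>, m - 1\<close>, this bounds the number of separated pairs, and the
  bound is attained when \<open>A\<close> and \<open>B\<close> alternate. Double counting gives the lower bound for the
  separation dimension; the list of all alternating orders is optimal by symmetry.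
\<close>

section \<open>Ordered pairs, quadruples and ranks\<close>

definition distinct_pairs :: "'a set \<Rightarrow> ('a \<times> 'a) set" where
  "distinct_pairs X = (SIGMA x:X. X - {x})"

lemma finite_distinct_pairs: "finite X \<Longrightarrow> finite (distinct_pairs X)"
  by (simp add: distinct_pairs_def)

lemma card_distinct_pairs:
  assumes "finite X"
  shows "card (distinct_pairs X) = card X * (card X - 1)"
  using assms by (simp add: distinct_pairs_def)

text \<open>Integer subtraction keeps the later ring identities free of truncation. For empty
  \<open>X\<close> the second factor is -1, and the factor 0 absorbs it.\<close>

lemma int_card_distinct_pairs:
  assumes "finite X"
  shows "int (card (distinct_pairs X)) = int (card X) * (int (card X) - 1)"
  using assms by (cases "card X") (simp_all add: card_distinct_pairs algebra_simps)

definition rank_separates :: "('a \<Rightarrow> nat) \<Rightarrow> 'a set \<Rightarrow> 'a set \<Rightarrow> bool" where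
  "rank_separates h e f \<longleftrightarrow> (\<forall>x\<in>e. \<forall>y\<in>f. h x < h y) \<or> (\<forall>x\<in>e. \<forall>y\<in>f. h y < h x)"

text \<open>\<open>((a, a'), (b, b'))\<close> encodes the ordered pair of nonincident edges
  \<open>{a, b}\<close> and \<open>{a', b'}\<close>; exchanging \<open>b\<close> and
  \<open>b'\<close> gives the other perfect matching on the same four vertices.\<close>

definition quads :: "'a set \<Rightarrow> 'a set \<Rightarrow> (('a \<times> 'a) \<times> 'a \<times> 'a) set" where
  "quads A B = distinct_pairs A \<times> distinct_pairs B"

definition separated_quads :: "('a \<Rightarrow> nat) \<Rightarrow> 'a set \<Rightarrow> 'a set \<Rightarrow> (('a \<times> 'a) \<times> 'a \<times> 'a) set" where
  "separated_quads h A B =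
     {q \<in> quads A B. case q of ((a, a'), (b, b')) \<Rightarrow> rank_separates h {a, b} {a', b'}}"

lemma finite_quads: "finite A \<Longrightarrow> finite B \<Longrightarrow> finite (quads A B)"
  by (simp add: quads_def finite_distinct_pairs)

text \<open>The number of smaller elements grows strictly with \<open>h\<close>, so it is injective,
  and it stays below \<open>card A\<close>; equal cardinalities give surjectivity.\<close>

lemma bij_betw_rank:
  fixes h :: "'a \<Rightarrow> nat"
  assumes "finite A" "inj_on h A"
  shows "bij_betw (\<lambda>a. card {c \<in> A. h c < h a}) A {..<card A}"
proof -
  let ?p = "\<lambda>a. card {c \<in> A. h c < h a}"
  have less: "?p a < ?p b" if "a \<in> A" "b \<in> A" "h a < h b" for a b
    by (rule psubset_card_mono) (use assms that in auto)
  have "inj_on ?p A"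
  proof (rule inj_onI)
    fix a b assume ab: "a \<in> A" "b \<in> A" "?p a = ?p b"
    then have "h a = h b"
      using less[of a b] less[of b a] by (cases "h a" "h b" rule: linorder_cases) simp_all
    then show "a = b" using assms(2) ab by (simp add: inj_on_eq_iff)
  qed
  moreover have "?p ` A \<subseteq> {..<card A}"
    using assms(1) by (auto intro!: psubset_card_mono)
  ultimately show ?thesis
    by (simp add: bij_betw_def card_image card_subset_eq)
qed

text \<open>Up to the factor 6 this counts the three-element subsets of \<open>{..<m}\<close> by
  their middle element \<open>p\<close>: there are \<open>p\<close> choices below and
  \<open>m - 1 - p\<close> above. The factor 6 avoids division.\<close>

lemma sum_mult_complement:
  "(\<Sum>p<m. 6 * (int p * (int m - 1 - int p))) = int m * (int m - 1) * (int m - 2)"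
proof (induction m)
  case (Suc m)
  have g: "(\<Sum>p<m. 2 * int p) = int m * (int m - 1)"
    by (induction m) (auto simp: algebra_simps)
  \<comment> \<open>Raising \<open>m\<close> by one adds \<open>6 * p\<close> to each old term; the
    new term \<open>p = m\<close> vanishes.\<close>
  have "(\<Sum>p<m. 6 * (int p * (int (Suc m) - 1 - int p)))
      = (\<Sum>p<m. 6 * (int p * (int m - 1 - int p))) + 3 * (\<Sum>p<m. 2 * int p)"
    by (simp add: sum_distrib_left sum.distrib[symmetric] algebra_simps)
  then show ?case
    unfolding sum.lessThan_Suc Suc.IH g by (simp add: algebra_simps)
qed simp

section \<open>Exact count of the pairs separated by one order\<close>

text \<open>Look at the two lowest of the four vertices. If they come from different parts, exactly
  one of the two matchings is separated, and swapping \<open>b\<close> and \<open>b'\<close>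
  exchanges these cases. Otherwise the two vertices of \<open>A\<close> lie on one side of both
  vertices of \<open>B\<close>; the sum counts these by the vertex \<open>a\<close> of
  \<open>A\<close> nearer to \<open>B\<close>, doubled because \<open>a\<close> may be first or
  second in its pair.\<close>

lemma card_quads_split:
  fixes h :: "'a \<Rightarrow> nat"
  assumes fin: "finite A" "finite B" and disj: "A \<inter> B = {}" and inj: "inj_on h (A \<union> B)"
  shows "card (quads A B) = 2 * card (separated_quads h A B)
    + 2 * (\<Sum>a\<in>A. card {c \<in> A. h c < h a} * card (distinct_pairs {b \<in> B. h a < h b})
                  + card {c \<in> A. h a < h c} * card (distinct_pairs {b \<in> B. h b < h a}))"
proof -
  define S where "S = separated_quads h A B"
  define S' where "S' = (\<lambda>((a, a'), (b, b')). ((a, a'), (b', b))) ` S"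
  \<comment> \<open>In \<open>F\<close> both vertices of \<open>A\<close> come first, in
    \<open>G\<close> both vertices of \<open>B\<close>; the first component is the vertex of
    \<open>A\<close> nearer to \<open>B\<close>. Below, \<open>j\<close> puts it first in its pair
    and \<open>j'\<close> second.\<close>
  define F where "F = (SIGMA a:A. {c \<in> A. h c < h a} \<times> distinct_pairs {b \<in> B. h a < h b})"
  define G where "G = (SIGMA a:A. {c \<in> A. h a < h c} \<times> distinct_pairs {b \<in> B. h b < h a})"
  define j where "j = (\<lambda>(a :: 'a, a' :: 'a, q :: 'a \<times> 'a). ((a, a'), q))"
  define j' where "j' = (\<lambda>(a :: 'a, a' :: 'a, q :: 'a \<times> 'a). ((a', a), q))"
  have finFG: "finite F" "finite G"
    using fin by (auto simp: F_def G_def finite_distinct_pairs)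
  have neq: "h a \<noteq> h b" if "a \<in> A" "b \<in> B" for a b
    using inj disj that by (metis IntI UnI1 UnI2 empty_iff inj_onD)
  have neqA: "h a \<noteq> h b" if "a \<in> A" "b \<in> A" "a \<noteq> b" for a b
    using inj that by (metis UnI1 inj_onD)
  have neqB: "h a \<noteq> h b" if "a \<in> B" "b \<in> B" "a \<noteq> b" for a b
    using inj that by (metis UnI2 inj_onD)
  have S'_iff: "((a, a'), (b, b')) \<in> S' \<longleftrightarrow> ((a, a'), (b', b)) \<in> S" for a a' b b'
    by (force simp: S'_def)
  have S_iff: "((a, a'), (b, b')) \<in> S \<longleftrightarrow> a \<in> A \<and> a' \<in> A \<and> a \<noteq> a' \<and> b \<in> B \<and> b' \<in> B \<and> b \<noteq> b' \<and>
      (h a < h a' \<and> h a < h b' \<and> h b < h a' \<and> h b < h b' \<or>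
       h a' < h a \<and> h b' < h a \<and> h a' < h b \<and> h b' < h b)" for a a' b b'
    by (auto simp: S_def separated_quads_def quads_def distinct_pairs_def rank_separates_def)
  have F_iff: "(a, a', (b, b')) \<in> F \<longleftrightarrow> a \<in> A \<and> a' \<in> A \<and> b \<in> B \<and> b' \<in> B \<and> b \<noteq> b' \<and>
      h a' < h a \<and> h a < h b \<and> h a < h b'" for a a' b b'
    by (auto simp: F_def distinct_pairs_def)
  have G_iff: "(a, a', (b, b')) \<in> G \<longleftrightarrow> a \<in> A \<and> a' \<in> A \<and> b \<in> B \<and> b' \<in> B \<and> b \<noteq> b' \<and>
      h a < h a' \<and> h b < h a \<and> h b' < h a" for a a' b b'
    by (auto simp: G_def distinct_pairs_def)
  have j_iff: "((a, a'), q) \<in> j ` X \<longleftrightarrow> (a, a', q) \<in> X"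
    and j'_iff: "((a, a'), q) \<in> j' ` X \<longleftrightarrow> (a', a, q) \<in> X" for a a' q X
    by (force simp: j_def j'_def)+
  \<comment> \<open>With \<open>i, i', j, j'\<close> as the ranks of \<open>a, a', b, b'\<close>,
    the four lines of the disjunction describe \<open>S\<close>, \<open>S'\<close>, the image of
    \<open>F\<close> and \<open>G\<close> under the map \<open>j\<close>, and their image under
    \<open>j'\<close>.\<close>
  have trichotomy: "i < i' \<and> i < j' \<and> j < i' \<and> j < j' \<or> i' < i \<and> j' < i \<and> i' < j \<and> j' < j \<or>
      i < i' \<and> i < j \<and> j' < i' \<and> j' < j \<or> i' < i \<and> j < i \<and> i' < j' \<and> j < j' \<or>
      i' < i \<and> i < j \<and> i < j' \<or> i < i' \<and> j < i \<and> j' < i \<or>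
      i < i' \<and> i' < j \<and> i' < j' \<or> i' < i \<and> j < i' \<and> j' < i'"
    if "i \<noteq> i'" "i \<noteq> j" "i \<noteq> j'" "i' \<noteq> j" "i' \<noteq> j'" "j \<noteq> j'" for i i' j j' :: nat
    using that by (smt (verit) linorder_neqE_nat less_trans)
  have quads: "quads A B = (S \<union> S') \<union> (j ` (F \<union> G) \<union> j' ` (F \<union> G))"
  proof (intro set_eqI iffI; clarify)
    fix a a' b b'
    assume "((a, a'), (b, b')) \<in> quads A B"
    then have *: "a \<in> A" "a' \<in> A" "a \<noteq> a'" "b \<in> B" "b' \<in> B" "b \<noteq> b'"
      by (auto simp: quads_def distinct_pairs_def)
    then have "h a \<noteq> h a'" "h a \<noteq> h b" "h a \<noteq> h b'" "h a' \<noteq> h b" "h a' \<noteq> h b'" "h b \<noteq> h b'"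
      using neq neqA neqB by auto
    moreover assume "((a, a'), (b, b')) \<notin> j' ` (F \<union> G)"
      "((a, a'), (b, b')) \<notin> j ` (F \<union> G)" "((a, a'), (b, b')) \<notin> S'"
    ultimately show "((a, a'), (b, b')) \<in> S"
      using * trichotomy[of "h a" "h a'" "h b" "h b'"]
      unfolding j_iff j'_iff Un_iff S_iff S'_iff F_iff G_iff by metis
  next
    fix a a' b b'
    assume "((a, a'), (b, b')) \<in> (S \<union> S') \<union> (j ` (F \<union> G) \<union> j' ` (F \<union> G))"
    then have "a \<in> A \<and> a' \<in> A \<and> a \<noteq> a' \<and> b \<in> B \<and> b' \<in> B \<and> b \<noteq> b'"
      unfolding j_iff j'_iff Un_iff S_iff S'_iff F_iff G_iff by auto
    then show "((a, a'), (b, b')) \<in> quads A B"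
      by (auto simp: quads_def distinct_pairs_def)
  qed
  have disjointI: "X \<inter> Y = {}"
    if "\<And>a a' b b'. ((a, a'), (b, b')) \<in> X \<Longrightarrow> ((a, a'), (b, b')) \<in> Y \<Longrightarrow> False" for X Y :: "(('a \<times> 'a) \<times> 'a \<times> 'a) set"
    using that by auto
  have "S \<inter> S' = {}" "(S \<union> S') \<inter> (j ` (F \<union> G) \<union> j' ` (F \<union> G)) = {}"
    "j ` (F \<union> G) \<inter> j' ` (F \<union> G) = {}"
    by (rule disjointI; unfold j_iff j'_iff Un_iff S_iff S'_iff F_iff G_iff; linarith)+
  moreover have "F \<inter> G = {}"
    by (auto simp: F_def G_def)
  moreover have "finite S" "finite S'"
    using fin by (auto simp: S_def S'_def separated_quads_def finite_quads)
  moreover have "card S' = card S"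
    unfolding S'_def by (rule card_image) (auto simp: inj_on_def)
  moreover have "card (j ` X) = card X" "card (j' ` X) = card X" for X
    by (auto simp: j_def j'_def inj_on_def intro!: card_image)
  ultimately have "card (quads A B) = 2 * card S + 2 * (card F + card G)"
    unfolding quads using finFG by (simp add: card_Un_disjoint)
  moreover have "card F + card G
    = (\<Sum>a\<in>A. card {c \<in> A. h c < h a} * card (distinct_pairs {b \<in> B. h a < h b})
                  + card {c \<in> A. h a < h c} * card (distinct_pairs {b \<in> B. h b < h a}))"
    using fin by (simp add: F_def G_def card_cartesian_product finite_distinct_pairs sum.distrib)
  ultimately show ?thesis by (simp add: S_def)
qed

text \<open>The loss of an order is kept as an exact defect, the sum over
  \<open>(x a - p a) * (x a - p a - 1)\<close>. Dropping it gives the bound for all orders, and its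
  vanishing gives the count for alternating ones.\<close>

lemma card_separated_quads:
  fixes h :: "'a \<Rightarrow> nat"
  assumes fin: "finite A" "finite B" and card: "card A = m" "card B = m"
    and disj: "A \<inter> B = {}" and inj: "inj_on h (A \<union> B)"
  defines "p \<equiv> \<lambda>a. int (card {c \<in> A. h c < h a})" and "x \<equiv> \<lambda>a. int (card {b \<in> B. h b < h a})"
  shows "3 * int (card (separated_quads h A B)) + 3 * (int m - 1) * (\<Sum>a\<in>A. (x a - p a) * (x a - p a - 1))
    = int m * (int m - 1)\<^sup>2 * (int m + 1)"
proof -
  let ?S = "int (card (separated_quads h A B))"
  \<comment> \<open>The vertex \<open>a\<close> belongs to \<open>A\<close>, not to
    \<open>B\<close>, so only the count in \<open>A\<close> loses one.\<close>
  have above: "int (card {b \<in> B. h a < h b}) = int m - x a"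
    "int (card {c \<in> A. h a < h c}) = int m - 1 - p a" if "a \<in> A" for a
  proof -
    have "{b \<in> B. h b < h a} \<union> {b \<in> B. h a < h b} = B"
      using inj disj that by (auto simp: inj_on_def) (metis IntI UnI1 UnI2 empty_iff linorder_neqE_nat)
    moreover have "card ({b \<in> B. h b < h a} \<union> {b \<in> B. h a < h b}) = card {b \<in> B. h b < h a} + card {b \<in> B. h a < h b}"
      using fin by (intro card_Un_disjoint) auto
    ultimately show "int (card {b \<in> B. h a < h b}) = int m - x a"
      using card by (simp add: x_def)
    have "{b \<in> A. h b < h a} \<union> {b \<in> A. h a < h b} = A - {a}"
      using inj that by (auto simp: inj_on_def) (metis UnI1 linorder_neqE_nat)
    then have "card (A - {a}) = card ({b \<in> A. h b < h a} \<union> {b \<in> A. h a < h b})"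
      by simp
    moreover have "card A = Suc (card (A - {a}))"
      using fin(1) that by (rule card.remove)
    moreover have "card ({b \<in> A. h b < h a} \<union> {b \<in> A. h a < h b}) = card {b \<in> A. h b < h a} + card {b \<in> A. h a < h b}"
      using fin by (intro card_Un_disjoint) auto
    ultimately show "int (card {c \<in> A. h a < h c}) = int m - 1 - p a"
      using card by (simp add: p_def)
  qed
  have "int (card (quads A B)) = 2 * ?S +
      2 * (\<Sum>a\<in>A. p a * ((int m - x a) * (int m - x a - 1)) + (int m - 1 - p a) * (x a * (x a - 1)))"
    unfolding card_quads_split[OF fin disj inj]
    using fin by (simp add: int_card_distinct_pairs above cong: sum.cong) (simp add: p_def x_def)
  \<comment> \<open>The summand is split so that \<open>x a\<close> occurs only in a product of two
    consecutive integers; the other part involves only the ranks within \<open>A\<close>.\<close>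
  also have "(\<Sum>a\<in>A. p a * ((int m - x a) * (int m - x a - 1)) + (int m - 1 - p a) * (x a * (x a - 1)))
    = (int m - 1) * (\<Sum>a\<in>A. p a * (int m - 1 - p a)) + (int m - 1) * (\<Sum>a\<in>A. (x a - p a) * (x a - p a - 1))"
    unfolding sum_distrib_left sum.distrib[symmetric] by (rule sum.cong) (simp_all add: algebra_simps)
  finally have 1: "int (card (quads A B)) = 2 * ?S + 2 * ((int m - 1) * (\<Sum>a\<in>A. p a * (int m - 1 - p a))
      + (int m - 1) * (\<Sum>a\<in>A. (x a - p a) * (x a - p a - 1)))" .
  \<comment> \<open>Ranks within \<open>A\<close> run once through \<open>0, ..., m - 1\<close>, so
    this part of the sum is the same for every order.\<close>
  have "bij_betw (\<lambda>a. card {c \<in> A. h c < h a}) A {..<m}"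
    using bij_betw_rank[of A h] fin inj card by (simp add: inj_on_Un)
  from sum.reindex_bij_betw[OF this, of "\<lambda>p. 6 * (int p * (int m - 1 - int p))"]
  have 2: "6 * (\<Sum>a\<in>A. p a * (int m - 1 - p a)) = int m * (int m - 1) * (int m - 2)"
    by (simp add: sum_mult_complement sum_distrib_left p_def)
  have 3: "int (card (quads A B)) = (int m * (int m - 1)) * (int m * (int m - 1))"
    using fin by (simp add: quads_def card_cartesian_product int_card_distinct_pairs card)
  have e: "6 * ((int m - 1) * (\<Sum>a\<in>A. p a * (int m - 1 - p a))) = (int m - 1) * (int m * (int m - 1) * (int m - 2))"
    using 2 by (metis mult.left_commute)
  have lin: "6 * s + 6 * v = 3 * (2 * s + 2 * (u + v)) - w" if "6 * u = w" for s u v w :: int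
    using that by simp
  have "6 * ?S + 6 * ((int m - 1) * (\<Sum>a\<in>A. (x a - p a) * (x a - p a - 1)))
      = 3 * ((int m * (int m - 1)) * (int m * (int m - 1))) - (int m - 1) * (int m * (int m - 1) * (int m - 2))"
    using lin[OF e, of ?S "(int m - 1) * (\<Sum>a\<in>A. (x a - p a) * (x a - p a - 1))"]
    unfolding 1[symmetric] 3 .
  also have "\<dots> = 2 * (int m * (int m - 1)\<^sup>2 * (int m + 1))"
    by (simp add: power2_eq_square algebra_simps)
  finally have f: "6 * ?S + 6 * ((int m - 1) * (\<Sum>a\<in>A. (x a - p a) * (x a - p a - 1)))
      = 2 * (int m * (int m - 1)\<^sup>2 * (int m + 1))" .
  have "3 * s + 3 * n * v = w" if "6 * s + 6 * (n * v) = 2 * w" for s n v w :: int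
    using that by simp
  then show ?thesis using f .
qed

text \<open>The defect is nonnegative, since \<open>d * (d - 1)\<close> is nonnegative for every
  integer \<open>d\<close>.\<close>

lemma card_separated_quads_le:
  fixes h :: "'a \<Rightarrow> nat"
  assumes "finite A" "finite B" "card A = m" "card B = m" "A \<inter> B = {}" "inj_on h (A \<union> B)" "m \<ge> 1"
  shows "3 * int (card (separated_quads h A B)) \<le> int m * (int m - 1)\<^sup>2 * (int m + 1)"
proof -
  have "0 \<le> d * (d - 1)" for d :: int
    by (cases "d \<ge> 1") (auto intro: mult_nonneg_nonneg mult_nonpos_nonpos)
  then have nonneg: "0 \<le> 3 * (int m - 1) * (\<Sum>a\<in>A.
      (int (card {b \<in> B. h b < h a}) - int (card {c \<in> A. h c < h a})) *
      (int (card {b \<in> B. h b < h a}) - int (card {c \<in> A. h c < h a}) - 1))"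
    using assms(7) by (intro mult_nonneg_nonneg[of "3 * (int m - 1)"] sum_nonneg) auto
  have "s \<le> w" if "s + v = w" "0 \<le> v" for s v w :: int
    using that by simp
  then show ?thesis
    using card_separated_quads[OF assms(1-6)] nonneg .
qed

section \<open>Double counting and the lower bound\<close>

lemma card_quads:
  assumes "finite A" "finite B" "card A = m" "card B = m"
  shows "int (card (quads A B)) = (int m)\<^sup>2 * (int m - 1)\<^sup>2"
  using assms
  by (simp add: quads_def card_cartesian_product int_card_distinct_pairs power2_eq_square)

lemma sum_card_swap:
  assumes "finite I" "finite Q"
  shows "(\<Sum>q\<in>Q. card {i \<in> I. P i q}) = (\<Sum>i\<in>I. card {q \<in> Q. P i q})"
proof -
  have "(\<Sum>q\<in>Q. card {i \<in> I. P i q}) = (\<Sum>q\<in>Q. \<Sum>i\<in>I. if P i q then Suc 0 else 0)"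
    using assms by (simp add: card_eq_sum sum.inter_filter del: sum_constant)
  also have "\<dots> = (\<Sum>i\<in>I. \<Sum>q\<in>Q. if P i q then Suc 0 else 0)"
    by (rule sum.swap)
  also have "\<dots> = (\<Sum>i\<in>I. card {q \<in> Q. P i q})"
    using assms by (simp add: card_eq_sum sum.inter_filter del: sum_constant)
  finally show ?thesis .
qed

text \<open>Counting predecessors, \<open>x\<close> itself included, converts the relation into a
  rank function to which the quadruple count applies.\<close>

lemma linear_order_rank:
  assumes "finite V" "linear_order_on V r"
  obtains h :: "'a \<Rightarrow> nat" where "inj_on h V" "\<And>x y. x \<in> V \<Longrightarrow> y \<in> V \<Longrightarrow> (x, y) \<in> r \<longleftrightarrow> h x \<le> h y"
proof -
  define h where "h x = card {z \<in> V. (z, x) \<in> r}" for x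
  have r: "refl_on V r" "trans r" "antisym r" "total_on V r"
    using assms(2) by (auto simp: order_on_defs)
  have strict: "h x < h y" if "x \<in> V" "y \<in> V" "(x, y) \<in> r" "x \<noteq> y" for x y
    unfolding h_def
  proof (rule psubset_card_mono)
    have "(y, y) \<in> r" "(y, x) \<notin> r"
      using r that by (auto simp: refl_on_def dest: antisymD)
    then show "{z \<in> V. (z, x) \<in> r} \<subset> {z \<in> V. (z, y) \<in> r}"
      using that r(2) by (auto dest: transD)
  qed (use assms(1) in simp)
  have iff: "(x, y) \<in> r \<longleftrightarrow> h x \<le> h y" if "x \<in> V" "y \<in> V" for x y
  proof (cases "x = y")
    case True
    then show ?thesis using r(1) that by (simp add: refl_on_def)
  next
    case False
    then have "(x, y) \<in> r \<or> (y, x) \<in> r"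
      using r(4) that by (auto simp: total_on_def)
    then show ?thesis using strict[of x y] strict[of y x] that False by fastforce
  qed
  moreover have "inj_on h V"
    using iff r(3) by (auto simp: inj_on_def antisym_def)
  ultimately show ?thesis using that by blast
qed

lemma separates_iff_rank_separates:
  assumes "inj_on h V" "\<And>x y. x \<in> V \<Longrightarrow> y \<in> V \<Longrightarrow> (x, y) \<in> r \<longleftrightarrow> h x \<le> (h y :: nat)"
    and "e \<subseteq> V" "f \<subseteq> V" "e \<inter> f = {}"
  shows "separates r e f \<longleftrightarrow> rank_separates h e f"
proof -
  have "(x, y) \<in> r \<longleftrightarrow> h x < h y" "(y, x) \<in> r \<longleftrightarrow> h y < h x" if "x \<in> e" "y \<in> f" for x y
  proof -
    have "x \<in> V" "y \<in> V" "x \<noteq> y" using that assms by auto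
    then show "(x, y) \<in> r \<longleftrightarrow> h x < h y" "(y, x) \<in> r \<longleftrightarrow> h y < h x"
      using assms(1,2) by (metis inj_onD order_le_less)+
  qed
  then show ?thesis by (auto simp: separates_def rank_separates_def)
qed

lemma quads_edges:
  assumes "((a, a'), (b, b')) \<in> quads A B" "A \<inter> B = {}"
  shows "{a, b} \<subseteq> A \<union> B" "{a', b'} \<subseteq> A \<union> B" "{a, b} \<inter> {a', b'} = {}"
  using assms by (auto simp: quads_def distinct_pairs_def)

text \<open>Count the incidences between positions \<open>i\<close> of the list and quadruples
  separated by \<open>rs ! i\<close>. Every quadruple contributes at least \<open>t\<close>, and
  every order at most the bound for a single order.\<close>

lemma separating_list_length:
  assumes fin: "finite A" "finite B" and card: "card A = m" "card B = m" and disj: "A \<inter> B = {}"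
    and m: "m \<ge> 2" and sep: "separating_list (A \<union> B) {{a, b} | a b. a \<in> A \<and> b \<in> B} t rs"
  shows "3 * m * t \<le> (m + 1) * length rs"
proof -
  define P where "P i q = (case q of ((a, a'), (b, b')) \<Rightarrow> separates (rs ! i) {a, b} {a', b'})"
    for i and q :: "('a \<times> 'a) \<times> 'a \<times> 'a"
  let ?Q = "quads A B"
  have t: "t \<le> card {i \<in> {..<length rs}. P i q}" if q: "q \<in> ?Q" for q
  proof -
    obtain a a' b b' where [simp]: "q = ((a, a'), (b, b'))"
      by (metis surj_pair)
    have "a \<in> A" "a' \<in> A" "b \<in> B" "b' \<in> B"
      using q by (auto simp: quads_def distinct_pairs_def)
    moreover have "nonincident {a, b} {a', b'}"
      using quads_edges(3) q disj by (simp add: nonincident_def)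
    ultimately have "t \<le> card {i. i < length rs \<and> separates (rs ! i) {a, b} {a', b'}}"
      using sep unfolding separating_list_def by blast
    then show ?thesis by (simp add: P_def)
  qed
  have le: "3 * int (card {q \<in> ?Q. P i q}) \<le> int m * (int m - 1)\<^sup>2 * (int m + 1)" if "i < length rs" for i
  proof -
    have "linear_order_on (A \<union> B) (rs ! i)"
      using sep that by (auto simp: separating_list_def)
    then obtain h :: "'a \<Rightarrow> nat" where h: "inj_on h (A \<union> B)"
        "\<And>x y. x \<in> A \<union> B \<Longrightarrow> y \<in> A \<union> B \<Longrightarrow> (x, y) \<in> rs ! i \<longleftrightarrow> h x \<le> h y"
      using linear_order_rank fin by (metis finite_UnI)
    have "{q \<in> ?Q. P i q} = separated_quads h A B"
      using separates_iff_rank_separates[OF h quads_edges[OF _ disj]]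
      by (auto simp: separated_quads_def P_def)
    then show ?thesis
      using card_separated_quads_le[OF fin card disj h(1)] m by simp
  qed
  have "card ?Q * t \<le> (\<Sum>q\<in>?Q. card {i \<in> {..<length rs}. P i q})"
    using t sum_bounded_below[of ?Q t] by simp
  also have "\<dots> = (\<Sum>i<length rs. card {q \<in> ?Q. P i q})"
    using fin by (intro sum_card_swap) (auto simp: finite_quads)
  finally have "3 * int (card ?Q * t) \<le> (\<Sum>i<length rs. 3 * int (card {q \<in> ?Q. P i q}))"
    unfolding sum_distrib_left[symmetric] of_nat_sum[symmetric] by linarith
  also have "\<dots> \<le> int (length rs) * (int m * (int m - 1)\<^sup>2 * (int m + 1))"
    using sum_bounded_above[of "{..<length rs}" "\<lambda>i. 3 * int (card {q \<in> ?Q. P i q})"] le by simp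
  \<comment> \<open>Both sides are arranged to share the factor \<open>m * (m - 1)^2\<close>,
    positive as \<open>m \<ge> 2\<close>, which is then cancelled.\<close>
  finally have "(int m * (int m - 1)\<^sup>2) * int (3 * m * t) \<le> (int m * (int m - 1)\<^sup>2) * int ((m + 1) * length rs)"
    using card_quads[OF fin card] by (simp add: power2_eq_square algebra_simps)
  moreover have "int m * (int m - 1)\<^sup>2 > 0"
    using m by simp
  ultimately show ?thesis
    by (metis mult_le_cancel_left_pos of_nat_le_iff)
qed

section \<open>Alternating orders and the upper bound\<close>

text \<open>Being \<open>extensional\<close> fixes the values outside \<open>A \<union> B\<close>,
  so that there are only finitely many rankings to list and count.\<close>

definition alternating_ranks :: "'a set \<Rightarrow> 'a set \<Rightarrow> ('a \<Rightarrow> nat) set" where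
  "alternating_ranks A B = {h \<in> extensional (A \<union> B).
     bij_betw h A {i. i < 2 * card A \<and> even i} \<and> bij_betw h B {i. i < 2 * card A \<and> odd i}}"

lemma card_even_odd_below:
  "card {i. i < 2 * k \<and> even i} = k" "card {i :: nat. i < 2 * k \<and> odd i} = k"
proof (induction k)
  case (Suc k)
  have "{i. i < 2 * Suc k \<and> even i} = insert (2 * k) {i. i < 2 * k \<and> even i}"
    "{i. i < 2 * Suc k \<and> odd i} = insert (2 * k + 1) {i. i < 2 * k \<and> odd i}"
    by (auto simp: less_Suc_eq)
  with Suc show "card {i. i < 2 * Suc k \<and> even i} = Suc k" "card {i :: nat. i < 2 * Suc k \<and> odd i} = Suc k"
    by simp_all
qed simp_all

lemma finite_alternating_ranks:
  assumes "finite A" "finite B"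
  shows "finite (alternating_ranks A B)"
proof (rule finite_subset)
  show "alternating_ranks A B \<subseteq> (A \<union> B) \<rightarrow>\<^sub>E {..<2 * card A}"
    by (auto simp: alternating_ranks_def PiE_def dest: bij_betwE)
qed (use assms in \<open>simp add: finite_PiE\<close>)

lemma alternating_ranks_nonempty:
  assumes "finite A" "finite B" "card A = card B" "A \<inter> B = {}"
  shows "alternating_ranks A B \<noteq> {}"
proof -
  have "\<exists>f. bij_betw f A {i. i < 2 * card A \<and> even i}"
    by (rule finite_same_card_bij) (use assms in \<open>simp_all add: card_even_odd_below\<close>)
  then obtain f where f: "bij_betw f A {i. i < 2 * card A \<and> even i}" ..
  have "\<exists>g. bij_betw g B {i. i < 2 * card A \<and> odd i}"
    by (rule finite_same_card_bij) (use assms in \<open>simp_all add: card_even_odd_below\<close>)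
  then obtain g where g: "bij_betw g B {i. i < 2 * card A \<and> odd i}" ..
  let ?h = "restrict (\<lambda>v. if v \<in> A then f v else g v) (A \<union> B)"
  have "bij_betw ?h A {i. i < 2 * card A \<and> even i}"
    using f by (rule bij_betw_cong[THEN iffD1, rotated]) simp
  moreover have "bij_betw ?h B {i. i < 2 * card A \<and> odd i}"
    using g by (rule bij_betw_cong[THEN iffD1, rotated]) (use assms(4) in auto)
  ultimately have "?h \<in> alternating_ranks A B"
    by (auto simp: alternating_ranks_def)
  then show ?thesis by blast
qed

lemma inj_on_alternating_ranks:
  assumes "h \<in> alternating_ranks A B"
  shows "inj_on h (A \<union> B)"
  using assms unfolding alternating_ranks_def
  by (auto simp: inj_on_Un bij_betw_def)

text \<open>A vertex of \<open>A\<close> at position \<open>2 * k\<close> has exactly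
  \<open>k\<close> vertices of each part below it, so every \<open>x a - p a\<close> is 0 and the
  defect vanishes.\<close>

lemma card_alternating_separated_quads:
  assumes fin: "finite A" "finite B" and card: "card A = m" "card B = m"
    and disj: "A \<inter> B = {}" and h: "h \<in> alternating_ranks A B"
  shows "3 * int (card (separated_quads h A B)) = int m * (int m - 1)\<^sup>2 * (int m + 1)"
proof -
  have bij: "bij_betw h A {i. i < 2 * m \<and> even i}" "bij_betw h B {i. i < 2 * m \<and> odd i}"
    using h card by (auto simp: alternating_ranks_def)
  have "card {b \<in> B. h b < h a} = card {c \<in> A. h c < h a}" if "a \<in> A" for a
  proof -
    have "h a < 2 * m" "even (h a)"
      using bij_betwE[OF bij(1)] that by auto
    then obtain k where k: "h a = 2 * k" "2 * k < 2 * m" by (auto elim: evenE)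
    \<comment> \<open>The counts are read off in the image under \<open>h\<close>, where the two
      parts become even and odd numbers.\<close>
    have image: "h ` {c \<in> X. h c < h a} = {i \<in> h ` X. i < h a}" for X
      by auto
    have "h ` {c \<in> A. h c < h a} = {i. i < 2 * k \<and> even i}"
      unfolding image bij_betw_imp_surj_on[OF bij(1)] using k by auto
    moreover have "h ` {c \<in> B. h c < h a} = {i. i < 2 * k \<and> odd i}"
      unfolding image bij_betw_imp_surj_on[OF bij(2)] using k by auto
    moreover have "inj_on h {c \<in> A. h c < h a}" "inj_on h {c \<in> B. h c < h a}"
      using bij by (auto simp: bij_betw_def intro: inj_on_subset)
    then have "card (h ` {c \<in> A. h c < h a}) = card {c \<in> A. h c < h a}"
      "card (h ` {c \<in> B. h c < h a}) = card {c \<in> B. h c < h a}"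
      by (simp_all only: card_image)
    ultimately show ?thesis
      by (simp only: card_even_odd_below)
  qed
  then show ?thesis
    using card_separated_quads[OF fin card disj inj_on_alternating_ranks[OF h]] by simp
qed

lemma ex_permutes_two_points:
  assumes "a \<in> A" "a' \<in> A" "a \<noteq> a'" "c \<in> A" "c' \<in> A" "c \<noteq> c'"
  shows "\<exists>k. k permutes A \<and> k a = c \<and> k a' = c'"
proof (intro exI conjI)
  \<comment> \<open>First move \<open>a\<close> to \<open>c\<close>; this sends \<open>a'\<close> to
    \<open>?u\<close>, which differs from \<open>c\<close>. Then exchange \<open>?u\<close> with
    \<open>c'\<close>, which leaves \<open>c\<close> fixed.\<close>
  let ?u = "Transposition.transpose a c a'"
  let ?k = "Transposition.transpose ?u c' \<circ> Transposition.transpose a c"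
  have "?u \<in> A" using assms by (auto simp: Transposition.transpose_def)
  then show "?k permutes A"
    using assms by (intro permutes_compose permutes_swap_id)
  show "?k a = c" "?k a' = c'" using assms by (auto simp: Transposition.transpose_def)
qed

text \<open>Permuting within the parts acts transitively on the quadruples and preserves the
  alternating rankings, so no quadruple is favoured.\<close>

lemma card_alternating_separating_le:
  assumes fin: "finite A" "finite B" and disj: "A \<inter> B = {}"
    and q: "((a, a'), (b, b')) \<in> quads A B" and q': "((c, c'), (d, d')) \<in> quads A B"
  shows "card {h \<in> alternating_ranks A B. rank_separates h {c, d} {c', d'}}
    \<le> card {h \<in> alternating_ranks A B. rank_separates h {a, b} {a', b'}}"
proof -
  have abcd_in: "a \<in> A" "a' \<in> A" "a \<noteq> a'" "c \<in> A" "c' \<in> A" "c \<noteq> c'"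
    "b \<in> B" "b' \<in> B" "b \<noteq> b'" "d \<in> B" "d' \<in> B" "d \<noteq> d'"
    using q q' by (auto simp: quads_def distinct_pairs_def)
  obtain k where k: "k permutes A" "k a = c" "k a' = c'"
    using ex_permutes_two_points[OF abcd_in(1-6)] by blast
  obtain l where l: "l permutes B" "l b = d" "l b' = d'"
    using ex_permutes_two_points[OF abcd_in(7-12)] by blast
  define g where "g = k \<circ> l"
  have gA: "g x = k x" if "x \<in> A" for x
    using l(1) disj that by (auto simp: g_def permutes_def)
  have gB: "g x = l x" if "x \<in> B" for x
    using k(1) disj that permutes_in_image[OF l(1)] by (auto simp: g_def permutes_def)
  have g: "g permutes A \<union> B"
    unfolding g_def by (intro permutes_compose permutes_subset[OF k(1)] permutes_subset[OF l(1)]) auto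
  have "bij_betw g A A"
    using permutes_imp_bij[OF k(1)] bij_betw_cong[of A g k] gA by simp
  moreover have "bij_betw g B B"
    using permutes_imp_bij[OF l(1)] bij_betw_cong[of B g l] gB by simp
  \<comment> \<open>\<open>g\<close> maps each part onto itself, so the parts keep their parities;
    it fixes everything outside, so \<open>h \<circ> g\<close> stays extensional.\<close>
  ultimately have closed: "h \<circ> g \<in> alternating_ranks A B" if "h \<in> alternating_ranks A B" for h
    using that g unfolding alternating_ranks_def
    by (auto intro: bij_betw_trans simp: extensional_def permutes_def)
  have abcd: "g a = c" "g a' = c'" "g b = d" "g b' = d'"
    using abcd_in k l gA gB by simp_all
  show ?thesis
  proof (rule card_inj_on_le[where f = "\<lambda>h. h \<circ> g"])
    show "inj_on (\<lambda>h. h \<circ> g) {h \<in> alternating_ranks A B. rank_separates h {c, d} {c', d'}}"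
      using surj_fun_eq[OF permutes_surj[OF g]] by (intro inj_onI) (simp add: fun_eq_iff)
    show "(\<lambda>h. h \<circ> g) ` {h \<in> alternating_ranks A B. rank_separates h {c, d} {c', d'}}
        \<subseteq> {h \<in> alternating_ranks A B. rank_separates h {a, b} {a', b'}}"
      by (rule image_subsetI) (simp add: closed abcd rank_separates_def)
    show "finite {h \<in> alternating_ranks A B. rank_separates h {a, b} {a', b'}}"
      using finite_alternating_ranks[OF fin] by simp
  qed
qed

definition rank_order :: "'a set \<Rightarrow> ('a \<Rightarrow> nat) \<Rightarrow> 'a rel" where
  "rank_order V h = {(x, y). x \<in> V \<and> y \<in> V \<and> h x \<le> h y}"

lemma linear_order_on_rank_order:
  assumes "inj_on h V"
  shows "linear_order_on V (rank_order V h)"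
  using assms by (auto simp: order_on_defs rank_order_def refl_on_def total_on_def inj_on_def
      intro!: transI antisymI)

text \<open>Every quadruple is separated by the same number \<open>c\<close> of the \<open>N\<close>
  alternating orders, so the double count is an equation. Repeating the full list \<open>k\<close>
  times scales both numbers.\<close>

lemma separating_list_alternating:
  assumes fin: "finite A" "finite B" and card: "card A = m" "card B = m"
    and disj: "A \<inter> B = {}" and m: "m \<ge> 2"
  obtains c N where "c > 0" "N * (m + 1) = 3 * m * c"
    "\<forall>k. \<exists>rs. separating_list (A \<union> B) {{a, b} | a b. a \<in> A \<and> b \<in> B} (c * k) rs \<and> length rs = N * k"
proof -
  let ?R = "alternating_ranks A B" and ?Q = "quads A B"
  define P where "P h q = (case q of ((a, a'), (b, b')) \<Rightarrow> rank_separates h {a, b} {a', b'})"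
    for h :: "'a \<Rightarrow> nat" and q :: "('a \<times> 'a) \<times> 'a \<times> 'a"
  have finR: "finite ?R" using finite_alternating_ranks[OF fin] .
  have "card ?R \<noteq> 0"
    using alternating_ranks_nonempty[OF fin _ disj] finR card by simp
  have quads_pos: "int (card ?Q) > 0"
    using m by (simp add: card_quads[OF fin card])
  then obtain q0 where q0: "q0 \<in> ?Q" by (auto simp: card_gt_0_iff)
  \<comment> \<open>\<open>q0\<close> is an arbitrary reference quadruple; the symmetry inequality
    in both directions makes \<open>c\<close> independent of it.\<close>
  define c where "c = card {h \<in> ?R. P h q0}"
  have c: "card {h \<in> ?R. P h q} = c" if "q \<in> ?Q" for q
  proof -
    obtain a1 a2 b1 b2 where [simp]: "q = ((a1, a2), (b1, b2))" by (metis surj_pair)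
    obtain c1 c2 d1 d2 where [simp]: "q0 = ((c1, c2), (d1, d2))" by (metis surj_pair)
    show ?thesis
      unfolding c_def using that q0
      by (auto simp: P_def intro!: antisym card_alternating_separating_le[OF fin disj])
  qed
  have "(\<Sum>q\<in>?Q. card {h \<in> ?R. P h q}) = (\<Sum>h\<in>?R. card {q \<in> ?Q. P h q})"
    using fin finR by (intro sum_card_swap) (auto simp: finite_quads)
  moreover have "{q \<in> ?Q. P h q} = separated_quads h A B" for h
    by (auto simp: P_def separated_quads_def)
  ultimately have "card ?Q * c = (\<Sum>h\<in>?R. card (separated_quads h A B))"
    using c by simp
  then have "3 * int (card ?Q * c) = (\<Sum>h\<in>?R. 3 * int (card (separated_quads h A B)))"
    by (simp add: sum_distrib_left)
  also have "\<dots> = int (card ?R) * (int m * (int m - 1)\<^sup>2 * (int m + 1))"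
    using card_alternating_separated_quads[OF fin card disj] by simp
  finally have "(int m * (int m - 1)\<^sup>2) * int (card ?R * (m + 1)) = (int m * (int m - 1)\<^sup>2) * int (3 * m * c)"
    using card_quads[OF fin card] by (simp add: power2_eq_square algebra_simps)
  then have eq: "card ?R * (m + 1) = 3 * m * c"
    using m by (simp only: mult_cancel_left of_nat_eq_iff) simp
  then have "c > 0"
    using \<open>card ?R \<noteq> 0\<close> by (cases "c = 0") auto
  obtain hs where hs: "set hs = ?R" "distinct hs"
    using finite_distinct_list[OF finR] by blast
  define rs where "rs k = concat (replicate k (map (rank_order (A \<union> B)) hs))" for k
  have len: "length (rs k) = card ?R * k" for k
    using distinct_card[OF hs(2)] hs(1) by (induction k) (simp_all add: rs_def)
  have "separating_list (A \<union> B) {{a, b} | a b. a \<in> A \<and> b \<in> B} (c * k) (rs k)" for k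
    unfolding separating_list_def
  proof (intro conjI ballI impI)
    fix r assume "r \<in> set (rs k)"
    then have "r \<in> rank_order (A \<union> B) ` ?R"
      using hs(1) by (auto simp: rs_def split: if_splits)
    then show "linear_order_on (A \<union> B) r"
      using linear_order_on_rank_order inj_on_alternating_ranks by blast
  next
    fix e f
    assume "e \<in> {{a, b} | a b. a \<in> A \<and> b \<in> B}" "f \<in> {{a, b} | a b. a \<in> A \<and> b \<in> B}" "nonincident e f"
    then obtain a b a' b' where ef: "e = {a, b}" "f = {a', b'}" and
      q: "((a, a'), (b, b')) \<in> ?Q"
      by (auto simp: nonincident_def quads_def distinct_pairs_def)
    have iff: "separates (rank_order (A \<union> B) h) e f \<longleftrightarrow> P h ((a, a'), (b, b'))" if "h \<in> ?R" for h
      unfolding P_def prod.case ef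
      using inj_on_alternating_ranks[OF that] quads_edges[OF q disj]
      by (intro separates_iff_rank_separates) (auto simp: rank_order_def)
    have "length (filter (\<lambda>h. separates (rank_order (A \<union> B) h) e f) hs) = card {h \<in> ?R. P h ((a, a'), (b, b'))}"
      using hs iff by (simp add: distinct_card[OF distinct_filter, symmetric] cong: conj_cong)
    then have "length (filter (\<lambda>r. separates r e f) (map (rank_order (A \<union> B)) hs)) = c"
      using c[OF q] by (simp add: filter_map comp_def)
    then have "length (filter (\<lambda>r. separates r e f) (rs k)) = c * k"
      by (induction k) (simp_all add: rs_def)
    then show "c * k \<le> card {i. i < length (rs k) \<and> separates (rs k ! i) e f}"
      by (simp add: length_filter_conv_card)
  qed
  with len \<open>c > 0\<close> eq that show ?thesis by blast
qed

section \<open>The limit inferior of the quotients\<close>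

theorem mainTheorem3:
  fixes m :: nat and V :: "'a set" and E :: "'a set set"
  assumes "m \<ge> 2"
    and "is_complete_bipartite m m V E"
  shows "frac_sep_dim V E = ereal (3 * real m / (real m + 1))"
proof (rule antisym)
  obtain A B where fin: "finite A" "finite B" and card: "card A = m" "card B = m"
    and disj: "A \<inter> B = {}" and VE: "V = A \<union> B" "E = {{a, b} | a b. a \<in> A \<and> b \<in> B}"
    using assms(2) unfolding is_complete_bipartite_def by blast
  obtain c N where c: "c > 0" "N * (m + 1) = 3 * m * c"
    and ex: "\<forall>k. \<exists>rs. separating_list V E (c * k) rs \<and> length rs = N * k"
    by (rule separating_list_alternating[OF fin card disj assms(1), folded VE])
  have ratio: "real N / real c = 3 * real m / (real m + 1)"
    using arg_cong[OF c(2), of real] c(1) by (simp add: divide_simps algebra_simps)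
  let ?X = "\<lambda>t. ereal (real (sep_dim t V E) / real t)"
  \<comment> \<open>Passing to a subsequence can only raise the limit inferior; along multiples of
    \<open>c\<close> the repeated alternating lists are available.\<close>
  have "frac_sep_dim V E \<le> liminf (?X \<circ> (\<lambda>k. c * k))"
    unfolding frac_sep_dim_def using c(1) by (intro liminf_subseq_mono) (simp add: strict_mono_def)
  also have "\<dots> \<le> liminf (\<lambda>k. ereal (3 * real m / (real m + 1)))"
  proof (intro Liminf_mono always_eventually allI)
    fix k
    have "sep_dim (c * k) V E \<le> N * k"
      unfolding sep_dim_def by (rule Least_le) (rule ex[rule_format])
    then have "real (sep_dim (c * k) V E) / real (c * k) \<le> real (N * k) / real (c * k)"
      by (intro divide_right_mono of_nat_mono) simp_all
    \<comment> \<open>For \<open>k = 0\<close> the left-hand quotient is 0 by the convention for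
      division by zero.\<close>
    also have "\<dots> \<le> real N / real c"
      using c(1) by (cases "k = 0") simp_all
    finally show "(?X \<circ> (\<lambda>k. c * k)) k \<le> ereal (3 * real m / (real m + 1))"
      using ratio by simp
  qed
  also have "\<dots> = ereal (3 * real m / (real m + 1))"
    by (rule Liminf_const) simp
  finally show "frac_sep_dim V E \<le> ereal (3 * real m / (real m + 1))" .
  show "ereal (3 * real m / (real m + 1)) \<le> frac_sep_dim V E"
    unfolding frac_sep_dim_def
  \<comment> \<open>At \<open>t = 0\<close> the quotient is 0, so the bound is claimed only for
    positive \<open>t\<close>.\<close>
  proof (rule Liminf_bounded, rule eventually_mono[OF eventually_gt_at_top[of 0]])
    fix t :: nat assume "t > 0"
    have "\<exists>a rs. separating_list V E t rs \<and> length rs = a"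
      using exists_separating_list[OF complete_bipartite_simple_graph[OF assms(2)]] by blast
    from LeastI_ex[OF this] obtain rs where rs: "separating_list V E t rs" "length rs = sep_dim t V E"
      unfolding sep_dim_def by (elim exE conjE)
    have "3 * m * t \<le> (m + 1) * sep_dim t V E"
      using separating_list_length[OF fin card disj assms(1), folded VE, OF rs(1)] rs(2) by simp
    from of_nat_mono[OF this, where 'a = real] \<open>t > 0\<close>
    show "ereal (3 * real m / (real m + 1)) \<le> ?X t"
      by (simp add: divide_simps algebra_simps)
  qed
qed

end
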